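(* Let $\Omega$ be a finite nonempty set, let $\mathcal{L} := \{ g \in \mathbb{R}^{\Omega} : \min g = 0 \text{ and } \max g = 1 \}$, and let $\mathcal{K}$ be a finite subset of $\mathcal{L}$ that contains all singleton indicators $I_{\{\omega\}}$, $\omega \in \Omega$. Let $\underline{P} : \mathcal{K} \to \mathbb{R}$ be a lower prevision. Then $\underline{P}$ is coherent if and only if the following three conditions all hold: (i) $\underline{P}g \geq 0$ for all $g \in \mathcal{K}$; (ii) $\sum_{g \in \mathcal{N}} \lambda_g \, \underline{P}g \leq \underline{P}f$ for all linearly independent subsets $\mathcal{N}$ of $\mathcal{K}$ such that $1 < |\mathcal{N}| \leq |\Omega|$, all gambles $f \in \mathcal{K} \setminus \mathcal{N}$ such that $\operatorname{supp} f = \operatorname{supp} \mathcal{N}$, and all coefficient vectors $\lambda \in (\mathbb{R}_{>0})^{\mathcal{N}}$ such that $\sum_{g \in \mathcal{N}} \lambda_g \, g = f$; (iii) $\sum_{g \in \mathcal{N}} \lambda_g \, \underline{P}g \leq 1$ for all linearly independent subsets $\mathcal{N}$ of $\mathcal{K}$ such that $1 < |\mathcal{N}| \leq |\Omega|$ and $\operatorname{supp} \mathcal{N} = \Omega$, and all coefficient vectors $\lambda \in (\mathbb{R}_{\neq 0})^{\mathcal{N}}$ with at most one strictly negative component such that $\sum_{g \in \mathcal{N}} \lambda_g \, g = 1$ (the constant gamble $1$ on $\Omega$).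
   Context: A gamble is a function $g : \Omega \to \mathbb{R}$, where $\Omega$ is a finite set. For $A \subseteq \Omega$, the indicator $I_A$ is the gamble equal to $1$ on $A$ and $0$ elsewhere. A lower prevision on a finite set of gambles $\mathcal{K}$ is any real-valued function $\underline{P}$ on $\mathcal{K}$; its value at $g$ is written $\underline{P}g$. Coherence: a lower prevision $\underline{P}$ on a finite set of gambles $\mathcal{K}$ is coherent if and only if $$\sum_{g \in \mathcal{N}} \lambda_g \, \underline{P}g - \underline{P}f \;\leq\; \max_{\omega \in \Omega} \Big( \sum_{g \in \mathcal{N}} \lambda_g \, g(\omega) - f(\omega) \Big)$$ for all gambles $f \in \mathcal{K}$, all subsets $\mathcal{N}$ of $\mathcal{K}$ (possibly empty, possibly containing $f$), and all coefficient vectors $\lambda \in (\mathbb{R}_{>0})^{\mathcal{N}}$. For a gamble $f$, $\operatorname{supp} f = \{\omega \in \Omega : f(\omega) \neq 0\}$, and for a set of gambles $\mathcal{N}$, $\operatorname{supp} \mathcal{N} = \bigcup_{g \in \mathcal{N}} \operatorname{supp} g$. Linear independence is in the real vector space $\mathbb{R}^{\Omega}$. *)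

theory Defs
  imports "HOL-Analysis.Analysis"
begin

text \<open>
  The finite nonempty possibility space is the index type \<open>'w\<close>, and a gamble is a vector
  in \<open>real ^ 'w\<close>, so that linear independence is the library's notion \<open>independent\<close>.
\<close>

type_synonym 'w gamble = "real ^ 'w"

definition indicator_gamble :: "'w set \<Rightarrow> 'w::finite gamble" where
  "indicator_gamble A = (\<chi> \<omega>. indicator A \<omega>)"

definition normalized_gambles :: "'w::finite gamble set" where
  "normalized_gambles =
    {g. Min (range (\<lambda>\<omega>. g $ \<omega>)) = 0 \<and> Max (range (\<lambda>\<omega>. g $ \<omega>)) = 1}"

definition supp :: "'w::finite gamble \<Rightarrow> 'w set" where
  "supp f = {\<omega>. f $ \<omega> \<noteq> 0}"

definition Supp :: "'w::finite gamble set \<Rightarrow> 'w set" where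
  "Supp N = (\<Union>g\<in>N. supp g)"

text \<open>
  A lower prevision on a finite set \<open>K\<close> is represented by a total function of which only
  the values on \<open>K\<close> are used, and a coefficient vector indexed by \<open>N\<close> by a total function
  of which only the values on \<open>N\<close> are used. The definition is meant for finite \<open>K\<close>.
\<close>

definition coherent :: "'w::finite gamble set \<Rightarrow> ('w gamble \<Rightarrow> real) \<Rightarrow> bool" where
  "coherent K P \<longleftrightarrow>
    (\<forall>f\<in>K. \<forall>N. N \<subseteq> K \<longrightarrow>
      (\<forall>l :: 'w gamble \<Rightarrow> real. (\<forall>g\<in>N. l g > 0) \<longrightarrow>
        (\<Sum>g\<in>N. l g * P g) - P f
          \<le> Max (range (\<lambda>\<omega>. (\<Sum>g\<in>N. l g * g $ \<omega>) - f $ \<omega>))))"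

end

theory Submission
  imports Defs
begin

text \<open>
  For a fixed \<open>f\<close>, coherence bounds the linear program that maximizes
  \<open>\<Sum>g. \<lambda> g * P g - M\<close> over \<open>\<lambda>, M \<ge> 0\<close> with \<open>(\<Sum>g. \<lambda> g *\<^sub>R g) - M = f\<close>: the slack of the pointwise
  inequality is absorbed by the singleton indicators, and \<open>M \<ge> 0\<close> is automatic because \<open>f\<close>
  vanishes somewhere. The program only needs to be checked at basic solutions, where the
  vectors in use are linearly independent, and along rays. Rays and basic solutions with \<open>M > 0\<close>
  are instances of (iii), with \<open>f\<close> carrying the one possibly negative coefficient; basic
  solutions with \<open>M = 0\<close> are instances of (ii), or trivial.
\<close>

section \<open>Basic solutions of a linear program\<close>

text \<open>The fundamental theorem of linear programming for the objective \<open>c\<close>; the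
  second hypothesis says that no ray of the feasible cone improves it. While the vectors in use are
  dependent, moving along a linear relation that does not lower the objective brings some
  coefficient to zero, and that vector is dropped.\<close>

lemma exists_independent_improvement:
  fixes S :: "'a::real_vector set" and c l :: "'a \<Rightarrow> real"
  assumes "finite S"
    and "\<And>m. (\<forall>v\<in>S. m v \<ge> 0) \<Longrightarrow> (\<Sum>v\<in>S. m v *\<^sub>R v) = 0 \<Longrightarrow> (\<Sum>v\<in>S. m v * c v) \<le> 0"
    and "\<forall>v\<in>S. l v \<ge> 0"
  shows "\<exists>T m. T \<subseteq> S \<and> independent T \<and> (\<forall>v\<in>T. m v > 0) \<and>
    (\<Sum>v\<in>T. m v *\<^sub>R v) = (\<Sum>v\<in>S. l v *\<^sub>R v) \<and> (\<Sum>v\<in>S. l v * c v) \<le> (\<Sum>v\<in>T. m v * c v)"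
  using assms
proof (induction S arbitrary: l rule: finite_psubset_induct)
  case (psubset S)
  note fin = \<open>finite S\<close> and ray = psubset.prems(1) and nonneg = psubset.prems(2)
  \<comment> \<open>A zero coefficient at \<open>w\<close> hands the problem to the induction
    hypothesis for \<open>S - {w}\<close>. Both the case of a vanishing \<open>l w\<close> and the
    pivoted coefficients below end here.\<close>
  have drop: "\<exists>T m. T \<subseteq> S \<and> independent T \<and> (\<forall>v\<in>T. m v > 0) \<and>
      (\<Sum>v\<in>T. m v *\<^sub>R v) = (\<Sum>v\<in>S. k v *\<^sub>R v) \<and> (\<Sum>v\<in>S. k v * c v) \<le> (\<Sum>v\<in>T. m v * c v)"
    if w: "w \<in> S" "k w = 0" and k: "\<forall>v\<in>S. k v \<ge> 0" for k w
  proof -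
    have "\<exists>T m. T \<subseteq> S - {w} \<and> independent T \<and> (\<forall>v\<in>T. m v > 0) \<and>
      (\<Sum>v\<in>T. m v *\<^sub>R v) = (\<Sum>v\<in>S - {w}. k v *\<^sub>R v) \<and>
      (\<Sum>v\<in>S - {w}. k v * c v) \<le> (\<Sum>v\<in>T. m v * c v)"
    proof (rule psubset.IH)
      fix m assume m: "\<forall>v\<in>S - {w}. m v \<ge> 0" "(\<Sum>v\<in>S - {w}. m v *\<^sub>R v) = 0"
      \<comment> \<open>A ray over \<open>S - {w}\<close>, padded with zero at \<open>w\<close>, is
        a ray over \<open>S\<close>, so the ray hypothesis is inherited.\<close>
      have extend: "(\<Sum>v\<in>S. (m(w := 0)) v *\<^sub>R h v) = (\<Sum>v\<in>S - {w}. m v *\<^sub>R h v)"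
        for h :: "'a \<Rightarrow> 'b::real_vector"
        using fin by (intro sum.mono_neutral_cong_right) auto
      have "(\<Sum>v\<in>S. (m(w := 0)) v * c v) \<le> 0"
        using m extend[of "\<lambda>v. v"] by (intro ray) auto
      then show "(\<Sum>v\<in>S - {w}. m v * c v) \<le> 0"
        using extend[of c] by simp
    qed (use w k in auto)
    then show ?thesis
      using fin w by (auto simp: sum.remove[of S w])
  qed
  show ?case
  proof (cases "\<exists>w\<in>S. l w = 0")
    case True
    then show ?thesis using drop nonneg by blast
  next
    case False
    then have pos: "\<forall>v\<in>S. l v > 0"
      using nonneg by (simp add: order_less_le)
    show ?thesis
    proof (cases "independent S")
      case True
      then show ?thesis using pos by blast
    next
      case False
      then obtain r0 where r0: "(\<Sum>v\<in>S. r0 v *\<^sub>R v) = 0" "\<exists>v\<in>S. r0 v \<noteq> 0"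
        using dependent_finite[OF fin] by blast
      \<comment> \<open>A sign change makes the objective nonnegative along the relation. If no
        entry is negative then, the relation is a ray, so its objective is exactly zero and a second
        sign change is harmless.\<close>
      obtain r where r: "(\<Sum>v\<in>S. r v *\<^sub>R v) = 0" "\<exists>v\<in>S. r v < 0" "(\<Sum>v\<in>S. r v * c v) \<ge> 0"
      proof -
        obtain r1 where r1: "(\<Sum>v\<in>S. r1 v *\<^sub>R v) = 0" "\<exists>v\<in>S. r1 v \<noteq> 0" "(\<Sum>v\<in>S. r1 v * c v) \<ge> 0"
        proof (cases "(\<Sum>v\<in>S. r0 v * c v) \<ge> 0")
          case True
          then show ?thesis using that r0 by blast
        next
          case False
          then show ?thesis
            using that[of "\<lambda>v. - r0 v"] r0 by (simp add: sum_negf)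
        qed
        show ?thesis
        proof (cases "\<exists>v\<in>S. r1 v < 0")
          case True
          then show ?thesis using that r1 by blast
        next
          case False
          then have "\<forall>v\<in>S. r1 v \<ge> 0" by force
          moreover from this have "(\<Sum>v\<in>S. r1 v * c v) \<le> 0" using ray r1(1) by blast
          ultimately show ?thesis
            using that[of "\<lambda>v. - r1 v"] r1 by (force simp: sum_negf)
        qed
      qed
      define Q where "Q = {v\<in>S. r v < 0}"
      have Q: "finite Q" "Q \<noteq> {}" using fin r by (auto simp: Q_def)
      \<comment> \<open>The ratio test: \<open>t\<close> below is the largest step that keeps
        \<open>l + t * r\<close> nonnegative, and \<open>w\<close> is a vector whose coefficient
        reaches zero at that step.\<close>
      obtain w where w: "w \<in> Q" and min: "\<And>v. v \<in> Q \<Longrightarrow> l w / - r w \<le> l v / - r v"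
        using ex_min_if_finite[of "(\<lambda>v. l v / - r v) ` Q"] Q by (fastforce simp: not_less)
      define t where "t = l w / - r w"
      define k where "k = (\<lambda>v. l v + t * r v)"
      have wS: "w \<in> S" "r w < 0" using w by (auto simp: Q_def)
      have t: "t \<ge> 0" using wS nonneg by (simp add: t_def divide_nonneg_neg)
      have "k w = 0" using wS by (simp add: k_def t_def)
      moreover have "\<forall>v\<in>S. k v \<ge> 0"
      proof
        fix v assume v: "v \<in> S"
        show "k v \<ge> 0"
        proof (cases "r v < 0")
          case True
          then have "t \<le> l v / - r v" using min v by (simp add: Q_def t_def)
          then have "t * - r v \<le> l v" using True by (metis neg_0_less_iff_less pos_le_divide_eq)
          then show ?thesis by (simp add: k_def)
        next
          case False
          then show ?thesis using t nonneg v by (simp add: k_def)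
        qed
      qed
      moreover have "(\<Sum>v\<in>S. k v *\<^sub>R v) = (\<Sum>v\<in>S. l v *\<^sub>R v)"
        using r(1) by (simp add: k_def scaleR_add_left sum.distrib flip: scaleR_scaleR scaleR_right.sum)
      moreover have "(\<Sum>v\<in>S. k v * c v) = (\<Sum>v\<in>S. l v * c v) + t * (\<Sum>v\<in>S. r v * c v)"
        by (simp add: k_def distrib_right sum.distrib sum_distrib_left mult.assoc)
      moreover have "t * (\<Sum>v\<in>S. r v * c v) \<ge> 0" using t r(3) by simp
      ultimately show ?thesis using drop[of w k] wS(1) by (smt (verit))
    qed
  qed
qed

section \<open>Normalized gambles and their supports\<close>

lemma normalized_gamblesD:
  assumes "g \<in> normalized_gambles"
  shows "g $ \<omega> \<ge> 0" "g $ \<omega> \<le> 1" "\<exists>\<omega>. g $ \<omega> = 0" "\<exists>\<omega>. g $ \<omega> = 1"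
proof -
  let ?R = "range (\<lambda>\<omega>. g $ \<omega>)"
  have g: "Min ?R = 0" "Max ?R = 1"
    using assms by (auto simp: normalized_gambles_def)
  have "Min ?R \<in> ?R" "Max ?R \<in> ?R" by (intro Min_in Max_in; simp)+
  then show "\<exists>\<omega>. g $ \<omega> = 0" "\<exists>\<omega>. g $ \<omega> = 1" unfolding g by (metis imageE)+
  have "Min ?R \<le> g $ \<omega>" "g $ \<omega> \<le> Max ?R" by (intro Min_le Max_ge; simp)+
  then show "g $ \<omega> \<ge> 0" "g $ \<omega> \<le> 1" unfolding g .
qed

text \<open>Nonnegative values with positive weights cannot cancel. Hence the support requirement of
  condition (ii) follows from the equation for \<open>f\<close>.\<close>

lemma supp_sum_pos:
  assumes "finite N" "N \<subseteq> normalized_gambles" "\<forall>g\<in>N. l g > 0"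
  shows "supp (\<Sum>g\<in>N. l g *\<^sub>R g) = Supp N"
proof -
  have "(\<Sum>g\<in>N. l g * g $ \<omega>) = 0 \<longleftrightarrow> (\<forall>g\<in>N. g $ \<omega> = 0)" for \<omega>
    using assms normalized_gamblesD(1)
    by (subst sum_nonneg_eq_0_iff) (force simp: subset_iff intro!: mult_nonneg_nonneg)+
  then show ?thesis by (auto simp: supp_def Supp_def)
qed

section \<open>Consequences of conditions (iii) and (ii)\<close>

text \<open>Condition (iii) in the wording of the theorem, so that unfolding recovers it.\<close>

definition unit_combinations_bounded :: "'w::finite gamble set \<Rightarrow> ('w gamble \<Rightarrow> real) \<Rightarrow> bool" where
  "unit_combinations_bounded K P \<longleftrightarrow>
    (\<forall>N. \<forall>l :: 'w gamble \<Rightarrow> real.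
       N \<subseteq> K \<and> independent N \<and> 1 < card N \<and> card N \<le> CARD('w) \<and>
       Supp N = UNIV \<and>
       (\<forall>g\<in>N. l g \<noteq> 0) \<and> card {g \<in> N. l g < 0} \<le> 1 \<and>
       (\<Sum>g\<in>N. l g *\<^sub>R g) = (\<chi> \<omega>. 1)
       \<longrightarrow> (\<Sum>g\<in>N. l g * P g) \<le> 1)"

text \<open>Dividing by \<open>M\<close> and discarding zero coefficients leads to (iii). Its side
  conditions are automatic: the sum is nonzero at every point, so the support is everything, and
  independence bounds the cardinality by the dimension.\<close>

lemma constant_combination_bound:
  fixes K :: "'w::finite gamble set"
  assumes K: "K \<subseteq> normalized_gambles" and bnd: "unit_combinations_bounded K P"
    and N: "N \<subseteq> K" "independent N" and neg: "card {g \<in> N. l g < 0} \<le> 1"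
    and M: "M > 0" and eq: "(\<Sum>g\<in>N. l g *\<^sub>R g) = (\<chi> \<omega>. M)"
  shows "(\<Sum>g\<in>N. l g * P g) \<le> M"
proof -
  define N' where "N' = {g\<in>N. l g \<noteq> 0}"
  define m where "m g = l g / M" for g
  have finN: "finite N" using N(2) independent_bound by blast
  have N': "N' \<subseteq> N" "finite N'" using finN by (auto simp: N'_def)
  have ind: "independent N'" using N(2) N'(1) independent_mono by blast
  have sum_N': "(\<Sum>g\<in>N'. l g *\<^sub>R g) = (\<chi> \<omega>. M)" "(\<Sum>g\<in>N'. l g * P g) = (\<Sum>g\<in>N. l g * P g)"
    unfolding eq[symmetric]
    using finN by (auto simp: N'_def intro!: sum.mono_neutral_left)
  have pt: "(\<Sum>g\<in>N'. l g * g $ \<omega>) = M" for \<omega>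
    using arg_cong[OF sum_N'(1), of "\<lambda>x. x $ \<omega>"] by simp
  have ex: "\<exists>g\<in>N'. g $ \<omega> \<noteq> 0" for \<omega>
  proof (rule ccontr)
    assume "\<not> (\<exists>g\<in>N'. g $ \<omega> \<noteq> 0)"
    then have "(\<Sum>g\<in>N'. l g * g $ \<omega>) = 0" by (intro sum.neutral) auto
    then show False using pt[of \<omega>] M by simp
  qed
  \<comment> \<open>A single normalized gamble vanishes somewhere, so no multiple of it is a
    positive constant.\<close>
  have "1 < card N'"
  proof (rule ccontr)
    assume "\<not> 1 < card N'"
    moreover obtain h where h: "h \<in> N'" using ex by blast
    moreover have "card N' \<noteq> 0" using h N'(2) by auto
    ultimately have "N' = {h}" by (metis card_1_singletonE less_one linorder_neqE_nat singletonD)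
    moreover have "\<exists>\<omega>. h $ \<omega> = 0" using h N'(1) N(1) K normalized_gamblesD(3) by blast
    ultimately show False using ex by auto
  qed
  moreover have "card N' \<le> CARD('w)" using independent_bound[OF ind] by simp
  moreover have "Supp N' = UNIV" using ex by (auto simp: Supp_def supp_def)
  moreover have "\<forall>g\<in>N'. m g \<noteq> 0" using M by (auto simp: N'_def m_def)
  moreover have "card {g\<in>N'. m g < 0} \<le> 1"
  proof -
    have "{g\<in>N'. m g < 0} \<subseteq> {g\<in>N. l g < 0}"
      using M by (auto simp: N'_def m_def divide_less_0_iff)
    then have "card {g\<in>N'. m g < 0} \<le> card {g\<in>N. l g < 0}"
      using finN by (intro card_mono) auto
    then show ?thesis using neg by simp
  qed
  moreover have "(\<Sum>g\<in>N'. m g *\<^sub>R g) = (\<chi> \<omega>. 1)"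
    using pt M by (simp add: vec_eq_iff m_def flip: sum_divide_distrib)
  ultimately have "(\<Sum>g\<in>N'. m g * P g) \<le> 1"
    using bnd ind N'(1) N(1) unfolding unit_combinations_bounded_def by blast
  then show ?thesis using M by (simp add: m_def sum_N' flip: sum_divide_distrib)
qed

text \<open>This controls the rays of the program in \<open>dominating_combination_bound\<close>.
  The reduction to independent vectors applies because its own ray condition is trivial here, by
  \<open>zero\<close>.\<close>

lemma nonneg_combination_bound:
  fixes K :: "'w::finite gamble set"
  assumes finK: "finite K" and K: "K \<subseteq> normalized_gambles" and bnd: "unit_combinations_bounded K P"
    and l: "\<forall>g\<in>K. l g \<ge> 0" and M: "M \<ge> 0" and eq: "(\<Sum>g\<in>K. l g *\<^sub>R g) = (\<chi> \<omega>. M)"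
  shows "(\<Sum>g\<in>K. l g * P g) \<le> M"
proof -
  \<comment> \<open>At a point where \<open>g\<close> equals 1, a vanishing sum of nonnegative terms
    forces the coefficient of \<open>g\<close> to vanish.\<close>
  have zero: "m g = 0" if m: "\<forall>v\<in>K. m v \<ge> 0" "(\<Sum>v\<in>K. m v *\<^sub>R v) = 0" and g: "g \<in> K" for m g
  proof -
    obtain \<omega> where \<omega>: "g $ \<omega> = 1" using normalized_gamblesD(4) g K by blast
    have "(\<Sum>v\<in>K. m v * v $ \<omega>) = 0"
      using arg_cong[OF m(2), of "\<lambda>x. x $ \<omega>"] by simp
    then have "m g * g $ \<omega> = 0"
      using finK m(1) K g normalized_gamblesD(1)
      by (subst (asm) sum_nonneg_eq_0_iff) (force simp: subset_iff)+
    then show ?thesis using \<omega> by simp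
  qed
  show ?thesis
  proof (cases "M = 0")
    case True
    then have "\<forall>g\<in>K. l g = 0" using zero[OF l] eq by (auto simp: zero_vec_def)
    then show ?thesis using True by simp
  next
    case False
    have "\<exists>T m. T \<subseteq> K \<and> independent T \<and> (\<forall>v\<in>T. m v > 0) \<and>
      (\<Sum>v\<in>T. m v *\<^sub>R v) = (\<chi> \<omega>. M) \<and> (\<Sum>v\<in>K. l v * P v) \<le> (\<Sum>v\<in>T. m v * P v)"
      unfolding eq[symmetric]
    proof (rule exists_independent_improvement[OF finK _ l])
      fix m assume "\<forall>v\<in>K. m v \<ge> 0" "(\<Sum>v\<in>K. m v *\<^sub>R v) = 0"
      from zero[OF this] show "(\<Sum>v\<in>K. m v * P v) \<le> 0" by simp
    qed
    then obtain T m where T: "T \<subseteq> K" "independent T" "\<forall>v\<in>T. m v > 0"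
      "(\<Sum>v\<in>T. m v *\<^sub>R v) = (\<chi> \<omega>. M)" "(\<Sum>v\<in>K. l v * P v) \<le> (\<Sum>v\<in>T. m v * P v)"
      by (elim exE conjE)
    moreover have "{g\<in>T. m g < 0} = {}" using T(3) by force
    then have "card {g\<in>T. m g < 0} \<le> 1" by (simp only: card.empty)
    ultimately have "(\<Sum>v\<in>T. m v * P v) \<le> M"
      using False M by (intro constant_combination_bound[OF K bnd]) simp_all
    then show ?thesis using T(5) by simp
  qed
qed

text \<open>Condition (ii) in the wording of the theorem.\<close>

definition domination_bounded :: "'w::finite gamble set \<Rightarrow> ('w gamble \<Rightarrow> real) \<Rightarrow> bool" where
  "domination_bounded K P \<longleftrightarrow>
    (\<forall>N f. \<forall>l :: 'w gamble \<Rightarrow> real.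
       N \<subseteq> K \<and> independent N \<and> 1 < card N \<and> card N \<le> CARD('w) \<and>
       f \<in> K - N \<and> supp f = Supp N \<and>
       (\<forall>g\<in>N. l g > 0) \<and> (\<Sum>g\<in>N. l g *\<^sub>R g) = f
       \<longrightarrow> (\<Sum>g\<in>N. l g * P g) \<le> P f)"

text \<open>These are the basic solutions with \<open>M = 0\<close>. If \<open>f\<close> lies in
  \<open>N\<close>, independence leaves only the trivial representation of \<open>f\<close> by
  itself, and equality holds. Otherwise (ii) applies once \<open>N\<close> is known to have at least
  two elements.\<close>

lemma independent_representation_bound:
  fixes K :: "'w::finite gamble set"
  assumes K: "K \<subseteq> normalized_gambles" and bnd: "domination_bounded K P"
    and N: "N \<subseteq> K" "independent N" and f: "f \<in> K" and l: "\<forall>g\<in>N. l g > 0"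
    and eq: "(\<Sum>g\<in>N. l g *\<^sub>R g) = f"
  shows "(\<Sum>g\<in>N. l g * P g) \<le> P f"
proof -
  have finN: "finite N" using N(2) independent_bound by blast
  show ?thesis
  proof (cases "f \<in> N")
    case True
    have "(\<Sum>g\<in>N. (if g = f then 1 else 0) *\<^sub>R g) = f"
      using True finN by (simp add: if_distrib[of "\<lambda>x. x *\<^sub>R _"] cong: if_cong)
    then have "(\<Sum>g\<in>N. (l g - (if g = f then 1 else 0)) *\<^sub>R g) = 0"
      using eq by (simp only: scaleR_diff_left sum_subtractf) simp
    then have "l g = (if g = f then 1 else 0)" if "g \<in> N" for g
      using independentD[OF N(2) finN order_refl, of "\<lambda>g. l g - (if g = f then 1 else 0)" g] that
      by simp
    then have "(\<Sum>g\<in>N. l g * P g) = (\<Sum>g\<in>N. if g = f then P g else 0)"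
      by (intro sum.cong) auto
    then show ?thesis using True finN by simp
  next
    case False
    have "1 < card N"
    proof (rule ccontr)
      assume "\<not> 1 < card N"
      then consider "card N = 0" | "card N = 1" by linarith
      then show False
      proof cases
        case 1
        then have "f = 0" using eq finN by auto
        then show False using normalized_gamblesD(4)[of f] f K by auto
      next
        case 2
        then obtain g where g: "N = {g}" using card_1_singletonE by blast
        then have fg: "f = l g *\<^sub>R g" using eq by auto
        have gf: "g \<in> normalized_gambles" "f \<in> normalized_gambles" using g N f K by auto
        \<comment> \<open>If \<open>f\<close> is a multiple of \<open>g\<close>, evaluating at a
          maximum of each shows that the factor is 1, because both maxima are 1. Then
          \<open>f = g\<close>, contrary to the case assumption.\<close>
        obtain \<omega> \<omega>' where w: "g $ \<omega> = 1" "f $ \<omega>' = 1" using gf normalized_gamblesD(4) by metis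
        have "l g \<le> 1" using normalized_gamblesD(2)[OF gf(2), of \<omega>] w fg by simp
        moreover have "1 = l g * g $ \<omega>'" using w fg by simp
        moreover have "l g * g $ \<omega>' \<le> l g" using normalized_gamblesD(2)[OF gf(1), of \<omega>'] l g
          by (simp add: mult_left_le)
        ultimately have "l g = 1" by linarith
        then show False using fg g False by simp
      qed
    qed
    moreover have "card N \<le> CARD('w)" using independent_bound[OF N(2)] by simp
    moreover have "supp f = Supp N" using supp_sum_pos[OF finN _ l] N(1) K eq by auto
    ultimately show ?thesis
      using bnd N f l eq False unfolding domination_bounded_def by blast
  qed
qed

section \<open>Sufficiency of the three conditions\<close>

lemma dominating_combination_bound:
  fixes K :: "'w::finite gamble set"
  assumes finK: "finite K" and K: "K \<subseteq> normalized_gambles"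
    and dom: "domination_bounded K P" and bnd: "unit_combinations_bounded K P"
    and f: "f \<in> K" and l: "\<forall>g\<in>K. l g \<ge> 0" and M: "M \<ge> 0"
    and eq: "(\<Sum>g\<in>K. l g *\<^sub>R g) = f + (\<chi> \<omega>. M)"
  shows "(\<Sum>g\<in>K. l g * P g) \<le> P f + M"
proof -
  \<comment> \<open>The constant \<open>M\<close> becomes the coefficient of one more vector, the
    constant gamble -1, with objective value -1. As \<open>e\<close> takes negative values it lies
    outside \<open>K\<close>, so \<open>c\<close> agrees with \<open>P\<close> on
    \<open>K\<close>.\<close>
  define e :: "'w gamble" where "e = (\<chi> \<omega>. -1)"
  define c where "c v = (if v = e then -1 else P v)" for v
  have const: "x *\<^sub>R e = (\<chi> \<omega>. - x)" for x by (simp add: e_def vec_eq_iff)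
  have eK: "e \<notin> K"
  proof
    assume "e \<in> K"
    then have "e $ \<omega> \<ge> 0" for \<omega> using K normalized_gamblesD(1) by blast
    then show False by (simp add: e_def)
  qed
  have c: "(\<Sum>v\<in>T. m v * c v) = (\<Sum>v\<in>T. m v * P v)" if "T \<subseteq> K" for T m
    using that eK by (intro sum.cong) (auto simp: c_def)
  have "\<exists>T m. T \<subseteq> insert e K \<and> independent T \<and> (\<forall>v\<in>T. m v > 0) \<and>
      (\<Sum>v\<in>T. m v *\<^sub>R v) = (\<Sum>v\<in>insert e K. (l(e := M)) v *\<^sub>R v) \<and>
      (\<Sum>v\<in>insert e K. (l(e := M)) v * c v) \<le> (\<Sum>v\<in>T. m v * c v)"
  proof (rule exists_independent_improvement)
    \<comment> \<open>Along a ray, the gambles of \<open>K\<close> sum to the constant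
      \<open>m e\<close>, which \<open>nonneg_combination_bound\<close> handles.\<close>
    fix m :: "'w gamble \<Rightarrow> real"
    assume m: "\<forall>v\<in>insert e K. m v \<ge> 0" and "(\<Sum>v\<in>insert e K. m v *\<^sub>R v) = 0"
    then have "(\<Sum>v\<in>K. m v *\<^sub>R v) = (\<chi> \<omega>. m e)"
      using finK eK by (simp add: const vec_eq_iff)
    then have "(\<Sum>v\<in>K. m v * P v) \<le> m e"
      using m by (intro nonneg_combination_bound[OF finK K bnd]) auto
    then show "(\<Sum>v\<in>insert e K. m v * c v) \<le> 0"
      using finK eK by (simp add: c) (simp add: c_def)
  qed (use finK l M in auto)
  moreover have "(\<Sum>v\<in>K. (l(e := M)) v *\<^sub>R v) = (\<Sum>v\<in>K. l v *\<^sub>R v)"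
    "(\<Sum>v\<in>K. (l(e := M)) v * c v) = (\<Sum>v\<in>K. l v * P v)"
    using eK by (auto simp: c_def intro!: sum.cong)
  ultimately obtain T m where T: "T \<subseteq> insert e K" "independent T" "\<forall>v\<in>T. m v > 0"
    and Tf: "(\<Sum>v\<in>T. m v *\<^sub>R v) = f" and Tc: "(\<Sum>v\<in>K. l v * P v) - M \<le> (\<Sum>v\<in>T. m v * c v)"
    using finK eK by (auto simp: eq const vec_eq_iff c_def)
  have finT: "finite T" using T(2) independent_bound by blast
  have "(\<Sum>v\<in>T. m v * c v) \<le> P f"
  proof (cases "e \<in> T")
    case False
    then have "T \<subseteq> K" using T(1) by auto
    then show ?thesis
      using independent_representation_bound[OF K dom _ T(2) f T(3) Tf] c by simp
  next
    case True
    define N where "N = T - {e}"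
    have N: "N \<subseteq> K" "e \<notin> N" "finite N" "T = insert e N" using True T(1) finT by (auto simp: N_def)
    have indN: "independent N" and e_span: "e \<notin> span N"
      using T(2) N by (auto simp: independent_insert)
    have me: "m e > 0" using T(3) True by blast
    have sumN: "(\<Sum>v\<in>N. m v *\<^sub>R v) = f + (\<chi> \<omega>. m e)"
      using Tf N by (simp add: const vec_eq_iff algebra_simps)
    \<comment> \<open>If \<open>f\<close> were in the span of \<open>N\<close>, so would be
      \<open>f\<close> minus the sum, which is a nonzero multiple of \<open>e\<close>. This
      contradicts the independence of \<open>T\<close>.\<close>
    have indf: "independent (insert f N)"
    proof
      assume "dependent (insert f N)"
      then have "f \<in> span N" using indN by (metis independent_insert insert_absorb)
      moreover have "(\<Sum>v\<in>N. m v *\<^sub>R v) \<in> span N"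
        by (intro span_sum span_scale span_base)
      ultimately have "f - (\<Sum>v\<in>N. m v *\<^sub>R v) \<in> span N" by (rule span_diff)
      moreover have "f - (\<Sum>v\<in>N. m v *\<^sub>R v) = m e *\<^sub>R e" unfolding sumN const by (simp add: vec_eq_iff)
      ultimately have "(1 / m e) *\<^sub>R m e *\<^sub>R e \<in> span N" by (metis span_scale)
      then show False using me e_span by simp
    qed
    \<comment> \<open>The coefficients of the sum over \<open>N\<close> minus \<open>f\<close>. Only
      \<open>f\<close> can receive a negative one, as (iii) permits.\<close>
    define k where "k v = (if v \<in> N then m v else 0) - (if v = f then 1 else 0)" for v
    have "{g \<in> insert f N. k g < 0} \<subseteq> {f}" using T(3) N by (auto simp: k_def)
    then have "card {g \<in> insert f N. k g < 0} \<le> card {f}" by (intro card_mono) auto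
    then have neg: "card {g \<in> insert f N. k g < 0} \<le> 1" by simp
    have split: "(\<Sum>v\<in>insert f N. k v *\<^sub>R h v) = (\<Sum>v\<in>N. m v *\<^sub>R h v) - h f"
      for h :: "'w gamble \<Rightarrow> 'b::real_vector"
    proof -
      have "(\<Sum>v\<in>insert f N. k v *\<^sub>R h v) =
        (\<Sum>v\<in>insert f N. if v \<in> N then m v *\<^sub>R h v else 0) - (\<Sum>v\<in>insert f N. if v = f then h v else 0)"
        unfolding sum_subtractf[symmetric] by (intro sum.cong) (auto simp: k_def scaleR_diff_left)
      also have "(\<Sum>v\<in>insert f N. if v \<in> N then m v *\<^sub>R h v else 0) = (\<Sum>v\<in>N. m v *\<^sub>R h v)"
        using N(3) by (intro sum.mono_neutral_cong_right) auto
      finally show ?thesis using N(3) by simp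
    qed
    have "(\<Sum>v\<in>insert f N. k v *\<^sub>R v) = (\<chi> \<omega>. m e)" using split[of "\<lambda>v. v"] sumN by simp
    then have "(\<Sum>v\<in>insert f N. k v * P v) \<le> m e"
      using N(1) f by (intro constant_combination_bound[OF K bnd _ indf neg me]) auto
    then have "(\<Sum>v\<in>N. m v * P v) - P f \<le> m e" using split[of P] by simp
    moreover have "(\<Sum>v\<in>T. m v * c v) = (\<Sum>v\<in>N. m v * P v) - m e"
      using N by (simp add: c) (simp add: c_def)
    ultimately show ?thesis by simp
  qed
  then show ?thesis using Tc by simp
qed

lemma coherentI:
  fixes K :: "'w::finite gamble set"
  assumes finK: "finite K" and K: "K \<subseteq> normalized_gambles"
    and ind: "\<And>\<omega>. indicator_gamble {\<omega>} \<in> K" and nonneg: "\<forall>g\<in>K. P g \<ge> 0"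
    and dom: "domination_bounded K P" and bnd: "unit_combinations_bounded K P"
  shows "coherent K P"
  unfolding coherent_def
proof (intro ballI allI impI)
  fix f N and l :: "'w gamble \<Rightarrow> real"
  assume f: "f \<in> K" and N: "N \<subseteq> K" and l: "\<forall>g\<in>N. l g > 0"
  define M where "M = Max (range (\<lambda>\<omega>. (\<Sum>g\<in>N. l g * g $ \<omega>) - f $ \<omega>))"
  \<comment> \<open>The slack of the pointwise inequality, nonnegative because \<open>M\<close> is
    the maximum.\<close>
  define s where "s \<omega> = M + f $ \<omega> - (\<Sum>g\<in>N. l g * g $ \<omega>)" for \<omega>
  \<comment> \<open>The slack at each point becomes the weight of the corresponding singleton
    indicator. Adding these weights to \<open>l\<close> turns the inequality into an
    equation.\<close>
  define k where "k g = (\<Sum>\<omega>\<in>UNIV. if indicator_gamble {\<omega>} = g then s \<omega> else 0)" for g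
  define l' where "l' g = (if g \<in> N then l g else 0) + k g" for g
  have le_M: "(\<Sum>g\<in>N. l g * g $ \<omega>) - f $ \<omega> \<le> M" for \<omega>
    unfolding M_def by (intro Max_ge) auto
  have s: "s \<omega> \<ge> 0" for \<omega> using le_M[of \<omega>] unfolding s_def by linarith
  then have k: "k g \<ge> 0" for g unfolding k_def by (intro sum_nonneg) auto
  \<comment> \<open>At a zero of \<open>f\<close> the expression under the maximum is a nonnegative
    sum, hence \<open>M\<close> is nonnegative.\<close>
  obtain \<omega>0 where "f $ \<omega>0 = 0" using normalized_gamblesD(3) f K by blast
  moreover have "(\<Sum>g\<in>N. l g * g $ \<omega>0) \<ge> 0"
    using l N K normalized_gamblesD(1) by (force intro!: sum_nonneg mult_nonneg_nonneg)
  ultimately have M: "M \<ge> 0" using le_M[of \<omega>0] by linarith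
  have k_sum: "(\<Sum>g\<in>K. k g *\<^sub>R g) = (\<Sum>\<omega>\<in>UNIV. s \<omega> *\<^sub>R indicator_gamble {\<omega>})"
  proof -
    have "(\<Sum>g\<in>K. k g *\<^sub>R g) =
      (\<Sum>g\<in>K. \<Sum>\<omega>\<in>UNIV. if indicator_gamble {\<omega>} = g then s \<omega> *\<^sub>R g else 0)"
      unfolding k_def scaleR_left.sum by (intro sum.cong) auto
    also have "\<dots> = (\<Sum>\<omega>\<in>UNIV. \<Sum>g\<in>K. if indicator_gamble {\<omega>} = g then s \<omega> *\<^sub>R g else 0)"
      by (rule sum.swap)
    finally show ?thesis using finK ind by simp
  qed
  have k_sum': "(\<Sum>g\<in>K. k g *\<^sub>R g) $ \<omega> = s \<omega>" for \<omega>
    unfolding k_sum by (simp add: indicator_gamble_def indicator_def if_distrib cong: if_cong)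
  have l_sum: "(\<Sum>g\<in>K. (if g \<in> N then l g else 0) *\<^sub>R h g) = (\<Sum>g\<in>N. l g *\<^sub>R h g)"
    for h :: "'w gamble \<Rightarrow> 'b::real_vector"
    using finK N by (intro sum.mono_neutral_cong_right) auto
  have "(\<Sum>g\<in>K. l' g *\<^sub>R g) = (\<Sum>g\<in>N. l g *\<^sub>R g) + (\<Sum>g\<in>K. k g *\<^sub>R g)"
    unfolding l'_def scaleR_add_left sum.distrib l_sum[of "\<lambda>g. g"] by simp
  also have "\<dots> = f + (\<chi> \<omega>. M)"
    unfolding vec_eq_iff vector_add_component k_sum' by (simp add: s_def)
  finally have "(\<Sum>g\<in>K. l' g * P g) \<le> P f + M"
    using l k M by (intro dominating_combination_bound[OF finK K dom bnd f])
      (auto simp: l'_def less_imp_le add_nonneg_nonneg)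
  moreover have "(\<Sum>g\<in>K. l' g * P g) = (\<Sum>g\<in>N. l g * P g) + (\<Sum>g\<in>K. k g * P g)"
    using l_sum[of P] by (simp add: l'_def distrib_right sum.distrib)
  \<comment> \<open>Condition (i) enters here: the added indicator terms can only raise the
    left-hand side.\<close>
  moreover have "(\<Sum>g\<in>K. k g * P g) \<ge> 0"
    using k nonneg by (intro sum_nonneg) auto
  ultimately show "(\<Sum>g\<in>N. l g * P g) - P f \<le> Max (range (\<lambda>\<omega>. (\<Sum>g\<in>N. l g * g $ \<omega>) - f $ \<omega>))"
    unfolding M_def by linarith
qed

section \<open>Necessity of the three conditions\<close>

lemma coherentD:
  fixes K :: "'w::finite gamble set"
  assumes "coherent K P" "f \<in> K" "N \<subseteq> K" "\<forall>g\<in>N. l g > 0"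
    and eq: "\<And>\<omega>. (\<Sum>g\<in>N. l g * g $ \<omega>) - f $ \<omega> \<le> b"
  shows "(\<Sum>g\<in>N. l g * P g) - P f \<le> b"
proof -
  have "(\<Sum>g\<in>N. l g * P g) - P f \<le> Max (range (\<lambda>\<omega>. (\<Sum>g\<in>N. l g * g $ \<omega>) - f $ \<omega>))"
    using assms(1-4) unfolding coherent_def by blast
  also have "\<dots> \<le> b" using eq by (subst Max_le_iff) auto
  finally show ?thesis .
qed

text \<open>Coherence with the empty set of gambles bounds \<open>- P g\<close> by the maximum of
  \<open>- g\<close>, which is at most 0.\<close>

lemma coherent_nonneg:
  assumes "coherent K P" "K \<subseteq> normalized_gambles" "g \<in> K"
  shows "P g \<ge> 0"
  using coherentD[OF assms(1,3), of "{}" "\<lambda>_. 0" 0] assms normalized_gamblesD(1) by auto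

lemma coherent_domination_bounded:
  assumes "coherent K P"
  shows "domination_bounded K P"
  unfolding domination_bounded_def
proof (intro allI impI, elim conjE)
  fix N f and l :: "'a gamble \<Rightarrow> real"
  assume N: "N \<subseteq> K" "f \<in> K - N" "\<forall>g\<in>N. l g > 0" and eq: "(\<Sum>g\<in>N. l g *\<^sub>R g) = f"
  have "(\<Sum>g\<in>N. l g * g $ \<omega>) = f $ \<omega>" for \<omega> unfolding eq[symmetric] by simp
  then show "(\<Sum>g\<in>N. l g * P g) \<le> P f"
    using coherentD[OF assms, of f N l 0] N by auto
qed

text \<open>One gamble \<open>h\<close> of \<open>N\<close> takes the role of \<open>f\<close> in
  the definition of coherence; it is chosen so that all other coefficients are positive.\<close>

lemma coherent_unit_combinations_bounded:
  fixes K :: "'w::finite gamble set"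
  assumes coh: "coherent K P"
  shows "unit_combinations_bounded K P"
  unfolding unit_combinations_bounded_def
proof (intro allI impI, elim conjE)
  fix N and l :: "'w gamble \<Rightarrow> real"
  assume N: "N \<subseteq> K" "1 < card N" "\<forall>g\<in>N. l g \<noteq> 0" "card {g \<in> N. l g < 0} \<le> 1"
    and eq: "(\<Sum>g\<in>N. l g *\<^sub>R g) = (\<chi> \<omega>. 1)"
  have finN: "finite N" using N(2) card.infinite by fastforce
  have pt: "(\<Sum>g\<in>N. l g * g $ \<omega>) = 1" for \<omega>
    using arg_cong[OF eq, of "\<lambda>x. x $ \<omega>"] by simp
  obtain h where h: "h \<in> N" "\<forall>g\<in>N - {h}. l g > 0"
  proof (cases "{g \<in> N. l g < 0} = {}")
    case True
    then have "\<not> l g < 0" if "g \<in> N" for g using that by blast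
    then have pos: "l g > 0" if "g \<in> N" for g using N(3) that by (metis linorder_neqE)
    have "N \<noteq> {}" using N(2) by auto
    then obtain h where "h \<in> N" by blast
    then show ?thesis using that[of h] pos by blast
  next
    case False
    then have "card {g \<in> N. l g < 0} = 1"
      using N(4) finN by (simp add: Suc_le_eq card_gt_0_iff le_antisym)
    then obtain h where "{g \<in> N. l g < 0} = {h}" using card_1_singletonE by blast
    then have "h \<in> N" "\<forall>g\<in>N - {h}. \<not> l g < 0" by blast+
    then show ?thesis using that[of h] N(3) by (metis DiffD1 linorder_neqE)
  qed
  have rem: "(\<Sum>g\<in>N. l g * u g) = l h * u h + (\<Sum>g\<in>N - {h}. l g * u g)" for u
    using finN h(1) by (rule sum.remove)
  show "(\<Sum>g\<in>N. l g * P g) \<le> 1"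
  proof (cases "l h > 0")
    case True
    \<comment> \<open>Raising the coefficient of \<open>h\<close> by 1 compensates for the
      subtraction of \<open>h\<close>, so the coherence inequality is about the original
      sum.\<close>
    define k where "k = l(h := l h + 1)"
    have k: "(\<Sum>g\<in>N. k g * u g) = (\<Sum>g\<in>N. l g * u g) + u h" for u
      unfolding rem using finN h(1) by (simp add: sum.remove[of N h] k_def distrib_right)
    have "(\<Sum>g\<in>N. k g * P g) - P h \<le> 1"
      using h N(1) True pt by (intro coherentD[OF coh]) (auto simp: k, auto simp: k_def)
    then show ?thesis by (simp add: k)
  next
    case False
    then have neg: "l h < 0" using N(3) h(1) by force
    \<comment> \<open>Division by the positive number \<open>- l h\<close> gives \<open>h\<close>
      the coefficient -1, which coherence assigns to \<open>f\<close>.\<close>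
    have scaled: "(\<Sum>g\<in>N - {h}. l g / - l h * u g) - u h = (\<Sum>g\<in>N. l g * u g) / - l h" for u
    proof -
      have "(\<Sum>g\<in>N - {h}. l g / - l h * u g) = (\<Sum>g\<in>N - {h}. l g * u g) / - l h"
        by (simp add: sum_divide_distrib sum_negf)
      then show ?thesis unfolding rem using neg by (simp add: field_simps)
    qed
    have "(\<Sum>g\<in>N - {h}. l g / - l h * P g) - P h \<le> 1 / - l h"
    proof (rule coherentD[OF coh])
      show "(\<Sum>g\<in>N - {h}. l g / - l h * g $ \<omega>) - h $ \<omega> \<le> 1 / - l h" for \<omega>
        unfolding scaled[of "\<lambda>g. g $ \<omega>"] pt by simp
    qed (use h N(1) neg in \<open>auto simp: divide_pos_neg\<close>)
    then show ?thesis unfolding scaled using neg by (simp add: divide_le_cancel)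
  qed
qed

theorem mainTheorem1:
  fixes K :: "'w::finite gamble set" and P :: "'w gamble \<Rightarrow> real"
  assumes "finite K"
    and "K \<subseteq> normalized_gambles"
    and "\<And>\<omega>. indicator_gamble {\<omega>} \<in> K"
  shows "coherent K P \<longleftrightarrow>
    (\<forall>g\<in>K. P g \<ge> 0) \<and>
    (\<forall>N f. \<forall>l :: 'w gamble \<Rightarrow> real.
       N \<subseteq> K \<and> independent N \<and> 1 < card N \<and> card N \<le> CARD('w) \<and>
       f \<in> K - N \<and> supp f = Supp N \<and>
       (\<forall>g\<in>N. l g > 0) \<and> (\<Sum>g\<in>N. l g *\<^sub>R g) = f
       \<longrightarrow> (\<Sum>g\<in>N. l g * P g) \<le> P f) \<and>
    (\<forall>N. \<forall>l :: 'w gamble \<Rightarrow> real.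
       N \<subseteq> K \<and> independent N \<and> 1 < card N \<and> card N \<le> CARD('w) \<and>
       Supp N = UNIV \<and>
       (\<forall>g\<in>N. l g \<noteq> 0) \<and> card {g \<in> N. l g < 0} \<le> 1 \<and>
       (\<Sum>g\<in>N. l g *\<^sub>R g) = (\<chi> \<omega>. 1)
       \<longrightarrow> (\<Sum>g\<in>N. l g * P g) \<le> 1)"
proof -
  have "coherent K P \<longleftrightarrow>
    (\<forall>g\<in>K. P g \<ge> 0) \<and> domination_bounded K P \<and> unit_combinations_bounded K P"
    using coherentI[OF assms] coherent_nonneg[OF _ assms(2)] coherent_domination_bounded
      coherent_unit_combinations_bounded by blast
  then show ?thesis unfolding domination_bounded_def unit_combinations_bounded_def .
qed

end
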